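(* Let $f$ be a nonconstant meromorphic function on a domain $D\subset\mathbb{C}$. Let $\psi_n[f]$ be the Aharonov invariants of $f$, let $S_n[f]$ be Tamanoi's Schwarzian derivatives of $f$, and put $\sigma_n[f]=\dfrac{S_n[f]}{(n+1)!}$ for $n\ge0$. Then for every integer $n\ge2$, $$ \sigma_n[f]=\psi_n[f]+\sum_{k=2}^{n-2}\psi_k[f]\,\sigma_{n-k}[f] $$ at every point of $D$ where $f$ is locally univalent (an empty sum being $0$).
   Context: Aharonov invariants: for $z\in D$ with $f(z)\neq\infty$, $f'(z)\ne0$, the $\psi_n[f](z)$, $n\ge1$, are defined by the expansion, for small $w\neq0$, $$\frac{f'(z)}{f(z+w)-f(z)}=\frac1w-\sum_{n=1}^\infty \psi_n[f](z)w^{n-1}.$$ For $n\ge2$ they satisfy $\psi_n[M\circ f]=\psi_n[f]$ for Möbius transformations $M$. Tamanoi's Schwarzian derivatives: for $z\in D$ with $f(z)\neq\infty$, $f'(z)\neq0$, the $S_n[f](z)$, $n\ge0$, are defined by the expansion, for small $w$, $$ \frac{f'(z)(f(z+w)-f(z))}{\frac12f''(z)(f(z+w)-f(z))+f'(z)^2} =\sum_{n=0}^\infty S_n[f](z)\frac{w^{n+1}}{(n+1)!}; $$ the left side is $(M_z^{-1}\circ f)(z+w)$ where $M_z$ is the Möbius transformation with $M_z(0)=f(z)$, $M_z'(0)=f'(z)$, $M_z''(0)=f''(z)$. They are also invariant under $f\mapsto M\circ f$, $M$ Möbius. If $f(z)=\infty$ and $f$ is locally univalent (injective near $z$), then $\psi_n[f](z)$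 ($n\ge2$) and $S_n[f](z)$ ($n\ge0$) are defined as $\psi_n[M\circ f](z)$ and $S_n[M\circ f](z)$ for any Möbius $M$ with $M(\infty)\neq\infty$. *)

theory Defs
  imports "HOL-Complex_Analysis.Complex_Analysis"
begin

text \<open>
  A meromorphic function on a domain is represented by a function that is
  \<open>nicely_meromorphic_on\<close> it: removable singularities are removed, and the value at a pole is
  the dummy value 0. Hence \<open>f(z) = \<infinity>\<close> is rendered as \<open>is_pole f z\<close>, and \<open>sphere_value f\<close> is the
  associated map into the Riemann sphere, with \<open>None\<close> playing the role of \<open>\<infinity>\<close>.
\<close>

definition sphere_value :: "(complex \<Rightarrow> complex) \<Rightarrow> complex \<Rightarrow> complex option" where
  "sphere_value f z = (if is_pole f z then None else Some (f z))"

definition locally_univalent_at :: "(complex \<Rightarrow> complex) \<Rightarrow> complex \<Rightarrow> bool" where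
  "locally_univalent_at f z \<longleftrightarrow> (\<exists>r>0. inj_on (sphere_value f) (ball z r))"

text \<open>
  Composition of \<open>M(w) = (a w + b) / (c w + d)\<close> with a meromorphic function, where
  \<open>M(\<infinity>) = a / c\<close>. Where \<open>M \<circ> f\<close> takes the value \<open>\<infinity>\<close>, division by zero yields the dummy
  value 0, in accordance with the convention above.
\<close>

definition moebius_comp ::
  "complex \<Rightarrow> complex \<Rightarrow> complex \<Rightarrow> complex \<Rightarrow> (complex \<Rightarrow> complex) \<Rightarrow> complex \<Rightarrow> complex" where
  "moebius_comp a b c d f w =
     (if is_pole f w then a / c else (a * f w + b) / (c * f w + d))"

text \<open>
  The extension to poles of a quantity \<open>Q f z\<close> defined for \<open>f(z) \<noteq> \<infinity>\<close>: the common value of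
  \<open>Q (M \<circ> f) z\<close> over all Moebius transformations \<open>M\<close> with \<open>M(\<infinity>) \<noteq> \<infinity>\<close>, i.e. with \<open>c \<noteq> 0\<close>.
\<close>

definition extend_to_poles ::
  "((complex \<Rightarrow> complex) \<Rightarrow> complex \<Rightarrow> complex) \<Rightarrow> (complex \<Rightarrow> complex) \<Rightarrow> complex \<Rightarrow> complex" where
  "extend_to_poles Q f z =
     (if is_pole f z
      then THE v. \<forall>a b c d. a * d - b * c \<noteq> 0 \<and> c \<noteq> 0 \<longrightarrow> Q (moebius_comp a b c d f) z = v
      else Q f z)"

text \<open>
  The coefficient of \<open>w ^ (n - 1)\<close>, \<open>n \<ge> 1\<close>, in
  \<open>f'(z) / (f(z + w) - f(z)) = 1 / w - (\<Sum>n\<ge>1. \<psi>\<^sub>n[f](z) w ^ (n - 1))\<close> is \<open>- \<psi>\<^sub>n[f](z)\<close>.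
\<close>

definition aharonov_finite :: "nat \<Rightarrow> (complex \<Rightarrow> complex) \<Rightarrow> complex \<Rightarrow> complex" where
  "aharonov_finite n f z =
     - fls_nth (laurent_expansion (\<lambda>w. deriv f z / (f (z + w) - f z)) 0) (int n - 1)"

text \<open>At poles, the following is only meaningful for \<open>n \<ge> 2\<close>.\<close>

definition aharonov :: "nat \<Rightarrow> (complex \<Rightarrow> complex) \<Rightarrow> complex \<Rightarrow> complex" where
  "aharonov n = extend_to_poles (aharonov_finite n)"

text \<open>
  \<open>S\<^sub>n[f](z) / (n + 1)!\<close> is the coefficient of \<open>w ^ (n + 1)\<close> in the expansion of
  \<open>f'(z) (f(z + w) - f(z)) / (f''(z) / 2 * (f(z + w) - f(z)) + f'(z)\<^sup>2)\<close>.
\<close>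

definition tamanoi_finite :: "nat \<Rightarrow> (complex \<Rightarrow> complex) \<Rightarrow> complex \<Rightarrow> complex" where
  "tamanoi_finite n f z =
     fact (n + 1) *
     fps_nth (fps_expansion
       (\<lambda>w. deriv f z * (f (z + w) - f z) /
            (deriv (deriv f) z / 2 * (f (z + w) - f z) + (deriv f z)\<^sup>2)) 0) (n + 1)"

definition tamanoi :: "nat \<Rightarrow> (complex \<Rightarrow> complex) \<Rightarrow> complex \<Rightarrow> complex" where
  "tamanoi n = extend_to_poles (tamanoi_finite n)"

definition tamanoi_sigma :: "nat \<Rightarrow> (complex \<Rightarrow> complex) \<Rightarrow> complex \<Rightarrow> complex" where
  "tamanoi_sigma n f z = tamanoi n f z / fact (n + 1)"

end

theory Submission
  imports Defs
begin

text \<open>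
  Suppose first that \<open>f(z)\<close> is finite. Local univalence gives \<open>f'(z) \<noteq> 0\<close>. Write
  \<open>u = f(z + w) - f(z)\<close>, \<open>a = f'(z)\<close> and \<open>b = f''(z) / 2\<close>. Tamanoi's expansion is that of
  \<open>T = a u / (b u + a\<^sup>2)\<close>, and \<open>1 / T = a / u + b / a\<close>. Here \<open>a / u\<close> is Aharonov's expansion
  \<open>1 / w - (\<Sum>n\<ge>1. \<psi>\<^sub>n w ^ (n - 1))\<close>, whose constant coefficient is \<open>-\<psi>\<^sub>1 = - b / a\<close>. Since
  \<open>T / w = (\<Sum>n. \<sigma>\<^sub>n w ^ n)\<close>, it follows that
  \<open>(\<Sum>n. \<sigma>\<^sub>n w ^ n) (1 - (\<Sum>n\<ge>2. \<psi>\<^sub>n w ^ n)) = 1\<close> (lemma \<open>tamanoi_finite_eq_fps_nth\<close>). The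
  coefficients of this identity are the recursion; the term \<open>k = n - 1\<close> is absent because
  \<open>\<sigma>\<^sub>1 = 0\<close>, and the term \<open>k = n\<close> is \<open>\<psi>\<^sub>n\<close> because \<open>\<sigma>\<^sub>0 = 1\<close>.

  At a pole, \<open>f\<close> can be replaced by \<open>h = 1 / f\<close>, extended by \<open>h(z) = 0\<close>, which is analytic with
  \<open>h'(z) \<noteq> 0\<close>. Every \<open>M \<circ> f\<close> that is finite at \<open>z\<close> is a Moebius transformation of \<open>h\<close>, and a Moebius
  transformation changes \<open>f'(z) / (f(z + w) - f(z))\<close> only by an additive constant, that is,
  it changes only \<open>\<psi>\<^sub>1\<close> (lemma \<open>aharonov_finite_moebius\<close>). By the reciprocal relation above the \<open>\<sigma>\<^sub>n\<close>
  are determined by the \<open>\<psi>\<^sub>n\<close> with \<open>n \<ge> 2\<close>, so they are invariant too. Hence the values of the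
  invariants at the pole are those of \<open>h\<close>, and the finite case applies to \<open>h\<close>.
\<close>

section \<open>Power series of reciprocal differences\<close>

text \<open>
  If \<open>G\<close> is the expansion of \<open>w \<mapsto> g(z + w)\<close>, this is the expansion of
  \<open>w g'(z) / (g(z + w) - g(z))\<close>. The factor \<open>w\<close> removes the simple pole, which allows working
  with power series instead of Laurent series; shifting \<open>G\<close> drops its constant term.
\<close>

definition recip_diff_fps :: "complex fps \<Rightarrow> complex fps" where
  "recip_diff_fps G = fps_const (fps_nth G 1) * inverse (fps_shift 1 G)"

lemma recip_diff_fps_nth_0: "fps_nth G 1 \<noteq> 0 \<Longrightarrow> fps_nth (recip_diff_fps G) 0 = 1"
  by (simp add: recip_diff_fps_def)

lemma minus_const_eq_X_times_shift:
  fixes G :: "complex fps"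
  shows "G - fps_const (fps_nth G 0) = fps_X * fps_shift 1 G"
  by (rule fps_ext) auto

lemma recip_diff_fps_mult_shift:
  assumes "fps_nth G 1 \<noteq> 0"
  shows "recip_diff_fps G * fps_shift 1 G = fps_const (fps_nth G 1)"
  using assms by (simp add: recip_diff_fps_def mult.assoc inverse_mult_eq_1)

text \<open>
  As \<open>G - G(0)\<close> is a nonzero element of an integral domain, this equation has only one solution.
\<close>

lemma recip_diff_fps_eqI:
  assumes "fps_nth G 1 \<noteq> 0"
    and "P * (G - fps_const (fps_nth G 0)) = fps_const (fps_nth G 1) * fps_X"
  shows "recip_diff_fps G = P"
proof -
  have "fps_X * (P * fps_shift 1 G) = fps_X * (recip_diff_fps G * fps_shift 1 G)"
    using assms(2) unfolding minus_const_eq_X_times_shift recip_diff_fps_mult_shift[OF assms(1)]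
    by (simp add: mult_ac)
  moreover have "fps_shift 1 G \<noteq> 0"
    using assms(1) by (auto simp: fps_eq_iff)
  ultimately show ?thesis by simp
qed

lemma has_fps_expansion_imp_deriv:
  fixes g :: "complex \<Rightarrow> complex"
  assumes "(\<lambda>w. g (z + w)) has_fps_expansion G"
  shows "deriv g z = fps_nth G 1" and "deriv (deriv g) z = 2 * fps_nth G 2"
proof -
  have "fps_nth G n = (deriv ^^ n) g z / fact n" for n
    using fps_nth_fps_expansion[OF assms, of n] higher_deriv_shift_0[of n g z]
    by (simp add: o_def)
  from this[of 1] this[of 2] show "deriv g z = fps_nth G 1" "deriv (deriv g) z = 2 * fps_nth G 2"
    by (simp_all add: numeral_2_eq_2 mult.commute)
qed

section \<open>Generating functions of the invariants\<close>

lemma aharonov_finite_eq_fps_nth: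
  assumes G: "(\<lambda>w. g (z + w)) has_fps_expansion G" and G1: "fps_nth G 1 \<noteq> 0" and "n \<ge> 1"
  shows "aharonov_finite n g z = - fps_nth (recip_diff_fps G) n"
proof -
  let ?P = "recip_diff_fps G" and ?G = "G - fps_const (fps_nth G 0)"
  have g0: "g z = fps_nth G 0"
    using has_fps_expansion_imp_0_eq_fps_nth_0[OF G] by simp
  have "(\<lambda>w. g (z + w) - g z) has_laurent_expansion fps_to_fls ?G"
    unfolding g0 by (intro has_laurent_expansion_fps fps_expansion_intros G)
  hence "(\<lambda>w. deriv g z / (g (z + w) - g z)) has_laurent_expansion
           fls_const (deriv g z) / fps_to_fls ?G"
    by (intro laurent_expansion_intros)
  also have "fls_const (deriv g z) / fps_to_fls ?G = fls_shift 1 (fps_to_fls ?P)"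
  proof -
    have "?G \<noteq> 0"
      using G1 by (auto simp: fps_eq_iff)
    moreover have "?P * ?G = fps_const (fps_nth G 1) * fps_X"
      using recip_diff_fps_mult_shift[OF G1]
      by (simp add: minus_const_eq_X_times_shift mult_ac)
    hence "fps_to_fls ?P * fps_to_fls ?G = fls_const (deriv g z) * fls_X"
      by (metis has_fps_expansion_imp_deriv(1)[OF G] fls_times_fps_to_fls fps_const_to_fls fps_X_to_fls)
    hence "fls_shift 1 (fps_to_fls ?P) * fps_to_fls ?G = fls_const (deriv g z)"
      by (simp add: fls_shifted_times_simps fls_X_times_conv_shift)
    ultimately show ?thesis
      by (simp add: divide_eq_eq)
  qed
  finally have "laurent_expansion (\<lambda>w. deriv g z / (g (z + w) - g z)) 0 =
                  fls_shift 1 (fps_to_fls ?P)"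
    by (rule laurent_expansion_0_eqI)
  thus ?thesis
    using \<open>n \<ge> 1\<close> by (simp add: aharonov_finite_def)
qed

text \<open>
  The coefficient \<open>\<psi>\<^sub>1\<close> is left out: it is not invariant under Moebius transformations, and it is
  exactly what the constant \<open>f''(z) / (2 f'(z))\<close> in Tamanoi's normalisation removes.
\<close>

definition aharonov_fps :: "(complex \<Rightarrow> complex) \<Rightarrow> complex \<Rightarrow> complex fps" where
  "aharonov_fps g z = Abs_fps (\<lambda>n. if n \<ge> 2 then aharonov_finite n g z else 0)"

text \<open>
  The linear term on the right cancels the coefficient of \<open>w\<close> in \<open>w f'(z) / (f(z + w) - f(z))\<close>,
  which is \<open>- f''(z) / (2 f'(z))\<close>.
\<close>

lemma one_minus_aharonov_fps:
  assumes G: "(\<lambda>w. g (z + w)) has_fps_expansion G" and G1: "fps_nth G 1 \<noteq> 0"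
  shows "1 - aharonov_fps g z =
           recip_diff_fps G + fps_const (fps_nth G 2 / fps_nth G 1) * fps_X"
proof (rule fps_ext)
  fix n :: nat
  have "fps_nth (recip_diff_fps G * fps_shift 1 G) 1 = 0"
    unfolding recip_diff_fps_mult_shift[OF G1] by simp
  hence "fps_nth (recip_diff_fps G) 1 = - fps_nth G 2 / fps_nth G 1"
    using G1 by (simp add: fps_mult_nth recip_diff_fps_nth_0[OF G1] field_simps add_eq_0_iff
        numeral_2_eq_2)
  moreover have "n = 0 \<or> n = 1 \<or> n \<ge> 2" by linarith
  ultimately show "fps_nth (1 - aharonov_fps g z) n =
           fps_nth (recip_diff_fps G + fps_const (fps_nth G 2 / fps_nth G 1) * fps_X) n"
    using recip_diff_fps_nth_0[OF G1] aharonov_finite_eq_fps_nth[OF G G1, of n]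
    by (auto simp: aharonov_fps_def)
qed

text \<open>
  Tamanoi's series \<open>T\<close> is the image of \<open>f(z + w) - f(z)\<close> under a Moebius transformation chosen so
  that \<open>1 / T = f'(z) / (f(z + w) - f(z)) + f''(z) / (2 f'(z))\<close>. The added constant cancels
  \<open>\<psi>\<^sub>1\<close>, so \<open>1 / T = (1 - (\<Sum>n\<ge>2. \<psi>\<^sub>n w ^ n)) / w\<close>: the numbers \<open>\<sigma>\<^sub>n\<close> have the generating function
  reciprocal to \<open>1 - (\<Sum>n\<ge>2. \<psi>\<^sub>n w ^ n)\<close>.
\<close>

lemma tamanoi_finite_eq_fps_nth:
  assumes g: "g analytic_on {z}" "deriv g z \<noteq> 0"
  shows "tamanoi_finite n g z / fact (n + 1) = fps_nth (inverse (1 - aharonov_fps g z)) n"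
proof -
  define G where "G = fps_expansion g z"
  have G: "(\<lambda>w. g (z + w)) has_fps_expansion G"
    unfolding G_def by (rule analytic_at_imp_has_fps_expansion) fact
  have G1: "fps_nth G 1 \<noteq> 0"
    using has_fps_expansion_imp_deriv(1)[OF G] g(2) by simp
  define a b where "a = fps_nth G 1" and "b = fps_nth G 2"
  let ?G = "G - fps_const (fps_nth G 0)" and ?R = "1 - aharonov_fps g z"
  have a0: "a \<noteq> 0" using G1 by (simp add: a_def)
  have g0: "g z = fps_nth G 0"
    using has_fps_expansion_imp_0_eq_fps_nth_0[OF G] by simp
  have d: "deriv g z = a" "deriv (deriv g) z / 2 = b"
    using has_fps_expansion_imp_deriv[OF G] by (simp_all add: a_def b_def)
  define N where "N = fps_const b * ?G + fps_const (a\<^sup>2)"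
  have N0: "fps_nth N 0 \<noteq> 0" using a0 by (simp add: N_def)
  have "(\<lambda>w. (a * (g (z + w) - g z)) * inverse (b * (g (z + w) - g z) + a\<^sup>2))
          has_fps_expansion (fps_const a * ?G) * inverse N"
    unfolding g0 using N0 unfolding N_def
    by (intro fps_expansion_intros G) 
  hence T: "fps_expansion (\<lambda>w. deriv g z * (g (z + w) - g z) /
        (deriv (deriv g) z / 2 * (g (z + w) - g z) + (deriv g z)\<^sup>2)) 0
      = (fps_const a * ?G) * inverse N"
    unfolding d unfolding divide_inverse by (rule fps_expansion_eqI)
  have R: "?R = recip_diff_fps G + fps_const (b / a) * fps_X"
    using one_minus_aharonov_fps[OF G G1] by (simp add: a_def b_def)
  have R0: "fps_nth ?R 0 \<noteq> 0" by (simp add: aharonov_fps_def)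
  \<comment> \<open>This is \<open>1 / T = R / w\<close> with denominators cleared.\<close>
  have "?R * (fps_const a * ?G) = fps_X * N"
  proof -
    have "?R * (fps_const a * ?G) = fps_const a * (recip_diff_fps G * fps_shift 1 G) * fps_X
             + (fps_const a * fps_const (b / a)) * fps_X * ?G"
      by (simp add: R minus_const_eq_X_times_shift algebra_simps del: fps_const_mult)
    also have "\<dots> = fps_const (a\<^sup>2) * fps_X + fps_const b * fps_X * ?G"
      unfolding recip_diff_fps_mult_shift[OF G1] using a0
      by (simp add: power2_eq_square a_def)
    finally show ?thesis by (simp add: N_def algebra_simps)
  qed
  hence "inverse ?R * ?R * (fps_const a * ?G) * inverse N = inverse ?R * fps_X * (N * inverse N)"
    by (simp add: mult.assoc)
  hence "(fps_const a * ?G) * inverse N = inverse ?R * fps_X"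
    by (simp only: inverse_mult_eq_1[OF R0] inverse_mult_eq_1'[OF N0] mult_1_left mult_1_right)
  thus ?thesis
    unfolding tamanoi_finite_def T by (simp del: fact_Suc)
qed

section \<open>Moebius invariance\<close>

text \<open>
  With \<open>\<Delta> = p s - q r\<close>, \<open>e = r h(z) + s\<close> and \<open>u = h(z + w) - h(z)\<close>, the difference
  \<open>g(z + w) - g(z)\<close> equals \<open>\<Delta> u / (e (e + r u))\<close>, and \<open>g'(z) = \<Delta> h'(z) / e\<^sup>2\<close>. Dividing,
  \<open>g'(z) / (g(z + w) - g(z)) = h'(z) / u + r h'(z) / e\<close>: only the constant coefficient
  \<open>- \<psi>\<^sub>1\<close> changes.
\<close>

lemma aharonov_finite_moebius:
  assumes h: "h analytic_on {z}" "deriv h z \<noteq> 0"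
    and M: "p * s - q * r \<noteq> 0" "r * h z + s \<noteq> 0"
    and ev: "eventually (\<lambda>w. g w = (p * h w + q) / (r * h w + s)) (nhds z)"
    and "n \<ge> 2"
  shows "g analytic_on {z}" "deriv g z \<noteq> 0" "aharonov_finite n g z = aharonov_finite n h z"
proof -
  define H where "H = fps_expansion h z"
  have H: "(\<lambda>w. h (z + w)) has_fps_expansion H"
    unfolding H_def by (rule analytic_at_imp_has_fps_expansion) fact
  have H1: "fps_nth H 1 \<noteq> 0"
    using has_fps_expansion_imp_deriv(1)[OF H] h(2) by simp
  define e \<Delta> where "e = r * h z + s" and "\<Delta> = p * s - q * r"
  have h0: "h z = fps_nth H 0"
    using has_fps_expansion_imp_0_eq_fps_nth_0[OF H] by simp
  have e0: "e \<noteq> 0" "\<Delta> \<noteq> 0" using M by (simp_all add: e_def \<Delta>_def)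
  show an: "g analytic_on {z}"
  proof -
    have "(\<lambda>w. (p * h w + q) / (r * h w + s)) analytic_on {z}"
      using h M by (intro analytic_intros) auto
    thus ?thesis
      using analytic_at_cong[OF ev refl] by simp
  qed
  define G where "G = fps_expansion g z"
  have G: "(\<lambda>w. g (z + w)) has_fps_expansion G"
    unfolding G_def by (rule analytic_at_imp_has_fps_expansion) fact
  have g0: "g z = fps_nth G 0"
    using has_fps_expansion_imp_0_eq_fps_nth_0[OF G] by simp
  let ?H = "H - fps_const (fps_nth H 0)" and ?G = "G - fps_const (fps_nth G 0)"
  have rel: "?G * (fps_const e * (fps_const e + fps_const r * ?H)) = fps_const \<Delta> * ?H"
  proof (rule fps_expansion_unique_complex)
    show "(\<lambda>w. (g (z + w) - g z) * (e * (e + r * (h (z + w) - h z)))) has_fps_expansion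
            ?G * (fps_const e * (fps_const e + fps_const r * ?H))"
      unfolding g0 h0 by (intro fps_expansion_intros G H)
    have expn: "(\<lambda>w. \<Delta> * (h (z + w) - h z)) has_fps_expansion fps_const \<Delta> * ?H"
      unfolding h0 by (intro fps_expansion_intros H)
    have eq: "eventually (\<lambda>w. (g (z + w) - g z) * (e * (e + r * (h (z + w) - h z)))
                      = \<Delta> * (h (z + w) - h z)) (nhds 0)"
    proof -
      have "isCont h z" using h(1) by (rule analytic_at_imp_isCont)
      hence "((\<lambda>w. r * h w + s) \<longlongrightarrow> e) (nhds z)"
        unfolding e_def by (intro tendsto_intros) (simp add: isCont_def tendsto_at_iff_tendsto_nhds)
      hence "eventually (\<lambda>w. r * h w + s \<noteq> 0) (nhds z)"
        using e0(1) by (rule tendsto_imp_eventually_ne)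
      hence "eventually (\<lambda>w. (g w - g z) * (e * (e + r * (h w - h z))) = \<Delta> * (h w - h z)) (nhds z)"
        using ev
      proof eventually_elim
        case (elim w)
        have "g z = (p * h z + q) / e"
          using eventually_nhds_x_imp_x[OF ev] by (simp add: e_def)
        hence gz: "g z * e = p * h z + q" using e0 by simp
        have gw: "g w * (r * h w + s) = p * h w + q" using elim by simp
        have "e + r * (h w - h z) = r * h w + s" by (simp add: e_def algebra_simps)
        hence "(g w - g z) * (e * (e + r * (h w - h z)))
           = (g w * (r * h w + s)) * e - (g z * e) * (r * h w + s)"
          by (simp only:) (simp only: left_diff_distrib right_diff_distrib mult_ac)
        also have "\<dots> = (p * h w + q) * e - (p * h z + q) * (r * h w + s)"
          by (simp only: gw gz)
        also have "\<dots> = \<Delta> * (h w - h z)" by (simp add: e_def \<Delta>_def algebra_simps)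
        finally show ?case .
      qed
      thus ?thesis
        by (simp add: nhds_to_0[of z] eventually_filtermap)
    qed
    show "(\<lambda>w. (g (z + w) - g z) * (e * (e + r * (h (z + w) - h z)))) has_fps_expansion
                       fps_const \<Delta> * ?H"
      by (rule iffD2[OF has_fps_expansion_cong[OF eq refl] expn])
  qed
  have G1: "fps_nth G 1 * e\<^sup>2 = \<Delta> * fps_nth H 1"
    using arg_cong[OF rel, of "\<lambda>F. fps_nth F 1"]
    by (simp add: fps_mult_nth power2_eq_square)
  hence G1': "fps_nth G 1 \<noteq> 0" using H1 e0 by auto
  thus "deriv g z \<noteq> 0" using has_fps_expansion_imp_deriv(1)[OF G] by simp
  have PH: "recip_diff_fps H * ?H = fps_const (fps_nth H 1) * fps_X"
    using recip_diff_fps_mult_shift[OF H1] by (simp add: minus_const_eq_X_times_shift mult_ac)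
  have "recip_diff_fps G = recip_diff_fps H + fps_const (fps_nth H 1 * r / e) * fps_X"
  proof (rule recip_diff_fps_eqI[OF G1'])
    let ?P = "recip_diff_fps H + fps_const (fps_nth H 1 * r / e) * fps_X"
    let ?E = "fps_const e + fps_const r * ?H" and ?h = "fps_const (fps_nth H 1)"
    have "fps_nth ?E 0 \<noteq> 0" using e0 by simp
    hence "?E \<noteq> 0" by (metis fps_zero_nth)
    hence E0: "fps_const (e\<^sup>2) * ?E \<noteq> 0" using e0 by simp
    \<comment> \<open>Multiplying by the common denominator \<open>e\<^sup>2 (e + r u)\<close> makes \<open>rel\<close> applicable; it is
        cancelled at the end.\<close>
    have "?P * ?G * (fps_const (e\<^sup>2) * ?E) = fps_const e * ?P * (?G * (fps_const e * ?E))"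
      by (simp add: power2_eq_square mult_ac flip: fps_const_mult)
    also have "\<dots> = fps_const \<Delta> * (fps_const e * (recip_diff_fps H * ?H) +
                      (fps_const e * fps_const (fps_nth H 1 * r / e)) * fps_X * ?H)"
      unfolding rel by (simp add: algebra_simps del: fps_const_mult)
    also have "fps_const e * fps_const (fps_nth H 1 * r / e) = ?h * fps_const r"
      using e0 by simp
    also have "fps_const \<Delta> * (fps_const e * (recip_diff_fps H * ?H) + ?h * fps_const r * fps_X * ?H)
                 = (fps_const \<Delta> * ?h) * fps_X * ?E"
      unfolding PH by (simp add: algebra_simps del: fps_const_mult)
    also have "fps_const \<Delta> * ?h = fps_const (fps_nth G 1) * fps_const (e\<^sup>2)"
      using G1 by simp
    finally have "(?P * ?G) * (fps_const (e\<^sup>2) * ?E) =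
                    (fps_const (fps_nth G 1) * fps_X) * (fps_const (e\<^sup>2) * ?E)"
      by (simp only: mult_ac)
    thus "?P * ?G = fps_const (fps_nth G 1) * fps_X"
      by (rule iffD1[OF mult_right_cancel[OF E0]])
  qed
  thus "aharonov_finite n g z = aharonov_finite n h z"
    using \<open>n \<ge> 2\<close> aharonov_finite_eq_fps_nth[OF G G1', of n] aharonov_finite_eq_fps_nth[OF H H1, of n]
    by simp
qed

lemma tamanoi_finite_moebius:
  assumes h: "h analytic_on {z}" "deriv h z \<noteq> 0"
    and M: "p * s - q * r \<noteq> 0" "r * h z + s \<noteq> 0"
    and ev: "eventually (\<lambda>w. g w = (p * h w + q) / (r * h w + s)) (nhds z)"
  shows "tamanoi_finite n g z = tamanoi_finite n h z"
proof -
  note inv = aharonov_finite_moebius[OF assms]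
  have g: "g analytic_on {z}" "deriv g z \<noteq> 0" using inv(1,2)[of 2] by simp_all
  have "aharonov_fps g z = aharonov_fps h z"
    by (rule fps_ext) (simp add: aharonov_fps_def inv(3))
  hence "tamanoi_finite n g z / fact (n + 1) = tamanoi_finite n h z / fact (n + 1)"
    by (simp only: tamanoi_finite_eq_fps_nth[OF g] tamanoi_finite_eq_fps_nth[OF h])
  thus ?thesis by (simp del: fact_Suc)
qed

section \<open>Local univalence at finite points and at poles\<close>

text \<open>
  The definite description needs at least one admissible Moebius transformation in order to pin
  down the value; \<open>w \<mapsto> 1 / w\<close> serves.
\<close>

lemma extend_to_poles_eqI:
  assumes "is_pole f z"
    and "\<And>a b c d. a * d - b * c \<noteq> 0 \<Longrightarrow> c \<noteq> 0 \<Longrightarrow> Q (moebius_comp a b c d f) z = v"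
  shows "extend_to_poles Q f z = v"
proof -
  have "(THE v. \<forall>a b c d. a * d - b * c \<noteq> 0 \<and> c \<noteq> 0 \<longrightarrow> Q (moebius_comp a b c d f) z = v) = v"
  proof (rule the_equality)
    show "\<forall>a b c d. a * d - b * c \<noteq> 0 \<and> c \<noteq> 0 \<longrightarrow> Q (moebius_comp a b c d f) z = v"
      using assms(2) by blast
  next
    fix v' assume "\<forall>a b c d. a * d - b * c \<noteq> 0 \<and> c \<noteq> 0 \<longrightarrow> Q (moebius_comp a b c d f) z = v'"
    thus "v' = v"
      using assms(2)[where a = 0 and b = 1 and c = 1 and d = 0] by force
  qed
  thus ?thesis using assms(1) by (simp add: extend_to_poles_def)
qed

lemma locally_univalent_at_finite:
  assumes "f analytic_on {z}" "locally_univalent_at f z"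
  shows "deriv f z \<noteq> 0"
proof -
  from assms(1) obtain S where S: "open S" "z \<in> S" "f holomorphic_on S"
    using analytic_at by blast
  from assms(2) obtain r where r: "r > 0" "inj_on (sphere_value f) (ball z r)"
    by (auto simp: locally_univalent_at_def)
  have "\<not> is_pole f w" if "w \<in> S" for w
    using that S analytic_at analytic_at_imp_no_pole by blast
  hence "inj_on f (S \<inter> ball z r)"
    using r(2) by (auto simp: inj_on_def sphere_value_def)
  thus ?thesis
    using S r by (intro holomorphic_injective_imp_regular[of f "S \<inter> ball z r"])
      (auto intro: holomorphic_on_subset)
qed

text \<open>
  Injectivity of the sphere-valued map keeps other poles away from \<open>z\<close>, since \<open>\<infinity>\<close> is already taken at
  \<open>z\<close>. Near \<open>z\<close> the map \<open>1 / f\<close> is therefore holomorphic and, inversion being a bijection of the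
  sphere, injective.
\<close>

lemma locally_univalent_at_pole:
  assumes D: "f nicely_meromorphic_on D" "open D" "z \<in> D"
    and pole: "is_pole f z" and univ: "locally_univalent_at f z"
  defines "h \<equiv> (\<lambda>w. if w = z then 0 else inverse (f w))"
  shows "h analytic_on {z}" "deriv h z \<noteq> 0"
    and "eventually (\<lambda>w. w \<noteq> z \<longrightarrow> \<not> is_pole f w \<and> f w \<noteq> 0) (nhds z)"
proof -
  from univ obtain r where r: "r > 0" "inj_on (sphere_value f) (ball z r)"
    by (auto simp: locally_univalent_at_def)
  have "eventually (\<lambda>w. w \<in> ball z r) (nhds z)" "eventually (\<lambda>w. w \<in> D) (nhds z)"
    by (intro eventually_nhds_in_open; use r D in simp)+
  moreover have "eventually (\<lambda>w. w \<noteq> z \<longrightarrow> f w \<noteq> 0) (nhds z)"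
    using non_zero_neighbour_pole[OF pole] by (simp add: eventually_at_filter)
  ultimately have "eventually (\<lambda>w. w \<in> ball z r \<and> w \<in> D \<and> (w \<noteq> z \<longrightarrow> f w \<noteq> 0)) (nhds z)"
    by eventually_elim auto
  then obtain S where S: "open S" "z \<in> S"
      "\<And>w. w \<in> S \<Longrightarrow> w \<in> ball z r \<and> w \<in> D \<and> (w \<noteq> z \<longrightarrow> f w \<noteq> 0)"
    unfolding eventually_nhds by blast
  have inj: "inj_on (sphere_value f) S"
    using r(2) S(3) by (meson inj_on_subset subsetI)
  have np: "\<not> is_pole f w" if "w \<in> S - {z}" for w
  proof
    assume "is_pole f w"
    hence "sphere_value f w = sphere_value f z" using pole by (simp add: sphere_value_def)
    thus False using inj that S(2) by (auto dest: inj_onD)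
  qed
  show "eventually (\<lambda>w. w \<noteq> z \<longrightarrow> \<not> is_pole f w \<and> f w \<noteq> 0) (nhds z)"
    unfolding eventually_nhds using S np by blast
  have "f analytic_on {w}" if "w \<in> S - {z}" for w
    using nicely_meromorphic_on_imp_analytic_at[OF D(1)] np that S(3) by blast
  hence "f analytic_on S - {z}"
    using analytic_on_analytic_at by blast
  hence "f holomorphic_on S - {z}"
    by (rule analytic_imp_holomorphic)
  hence h: "h holomorphic_on S"
    unfolding h_def using S pole by (intro is_pole_inverse_holomorphic) auto
  thus "h analytic_on {z}" using S analytic_at by blast
  have "inj_on h S"
  proof (rule inj_onI)
    fix x y assume xy: "x \<in> S" "y \<in> S" "h x = h y"
    hence "sphere_value f x = sphere_value f y"
      using S(3) np pole by (auto simp: h_def sphere_value_def split: if_splits)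
    thus "x = y" using inj xy by (auto dest: inj_onD)
  qed
  thus "deriv h z \<noteq> 0"
    using h S by (intro holomorphic_injective_imp_regular[of h S]) auto
qed

text \<open>
  The reduction of poles to finite points: the representative is \<open>f\<close> itself if \<open>f(z)\<close> is finite,
  and otherwise \<open>1 / f\<close>.
\<close>

lemma exists_finite_representative:
  assumes D: "f nicely_meromorphic_on D" "open D" "z \<in> D" and univ: "locally_univalent_at f z"
  obtains g where "g analytic_on {z}" "deriv g z \<noteq> 0"
    "\<And>k. k \<ge> 2 \<Longrightarrow> aharonov k f z = aharonov_finite k g z"
    "\<And>k. tamanoi k f z = tamanoi_finite k g z"
proof (cases "is_pole f z")
  case False
  hence "f analytic_on {z}"
    using nicely_meromorphic_on_imp_analytic_at[OF D(1,3)] by blast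
  thus ?thesis
    using that[of f] locally_univalent_at_finite[OF _ univ] False
    by (simp add: aharonov_def tamanoi_def extend_to_poles_def)
next
  case True
  define h where "h = (\<lambda>w. if w = z then 0 else inverse (f w))"
  note h = locally_univalent_at_pole[OF D True univ, folded h_def]
  \<comment> \<open>Substituting \<open>f = 1 / h\<close> turns \<open>(a f + b) / (c f + d)\<close> into \<open>(b h + a) / (d h + c)\<close>; the
      coefficients thus appear in swapped order. At \<open>z\<close> itself both sides are \<open>a / c\<close>.\<close>
  have ev: "eventually (\<lambda>w. moebius_comp a b c d f w = (b * h w + a) / (d * h w + c)) (nhds z)" 
    for a b c d
    using h(3)
  proof eventually_elim
    case (elim w)
    show ?case
    proof (cases "w = z")
      case False
      with elim have "f w \<noteq> 0" "\<not> is_pole f w" by auto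
      moreover from this have "f w * (x * inverse (f w) + y) = y * f w + x" for x y
        by (simp add: field_simps)
      hence "(a * f w + b) / (c * f w + d) =
          (f w * (b * inverse (f w) + a)) / (f w * (d * inverse (f w) + c))"
        by simp
      ultimately show ?thesis using False by (simp add: moebius_comp_def h_def)
    qed (use True in \<open>simp add: moebius_comp_def h_def\<close>)
  qed
  have h0: "h z = 0" by (simp add: h_def)
  show ?thesis
  proof (rule that[of h])
    fix k :: nat
    show "aharonov k f z = aharonov_finite k h z" if "k \<ge> 2"
      unfolding aharonov_def using True
    proof (rule extend_to_poles_eqI)
      fix a b c d :: complex assume "a * d - b * c \<noteq> 0" "c \<noteq> 0"
      thus "aharonov_finite k (moebius_comp a b c d f) z = aharonov_finite k h z"
        by (intro aharonov_finite_moebius(3)[OF h(1,2) _ _ ev that]) (auto simp: h0 algebra_simps)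
    qed
    show "tamanoi k f z = tamanoi_finite k h z"
      unfolding tamanoi_def using True
    proof (rule extend_to_poles_eqI)
      fix a b c d :: complex assume "a * d - b * c \<noteq> 0" "c \<noteq> 0"
      thus "tamanoi_finite k (moebius_comp a b c d f) z = tamanoi_finite k h z"
        by (intro tamanoi_finite_moebius[OF h(1,2) _ _ ev]) (auto simp: h0 algebra_simps)
    qed
  qed (use h in auto)
qed

section \<open>The recursion\<close>

theorem proposition2p3:
  fixes f :: "complex \<Rightarrow> complex" and D :: "complex set" and z :: complex and n :: nat
  assumes "open D" and "connected D"
    and "f nicely_meromorphic_on D"
    and "\<not> f constant_on D"
    and "n \<ge> 2"
    and "z \<in> D"
    and "locally_univalent_at f z"
  shows "tamanoi_sigma n f z =
           aharonov n f z + (\<Sum>k = 2..n - 2. aharonov k f z * tamanoi_sigma (n - k) f z)"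
proof -
  obtain g where g: "g analytic_on {z}" "deriv g z \<noteq> 0"
    and psi: "\<And>k. k \<ge> 2 \<Longrightarrow> aharonov k f z = aharonov_finite k g z"
    and tam: "\<And>k. tamanoi k f z = tamanoi_finite k g z"
    using exists_finite_representative[OF assms(3,1,6,7)] by blast
  define A where "A = aharonov_fps g z"
  define S where "S = inverse (1 - A)"
  have sig: "tamanoi_sigma k f z = fps_nth S k" for k
    using tamanoi_finite_eq_fps_nth[OF g, of k]
    by (simp add: tamanoi_sigma_def tam S_def A_def)
  have A: "fps_nth A k = (if k \<ge> 2 then aharonov k f z else 0)" for k
    by (simp add: A_def aharonov_fps_def psi)
  have "S * (1 - A) = 1"
    unfolding S_def by (rule inverse_mult_eq_1) (simp add: A)
  hence S: "S = 1 + A * S" by (simp add: algebra_simps)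
  have rec: "fps_nth S m = (if m = 0 then 1 else 0) + (\<Sum>k=0..m. fps_nth A k * fps_nth S (m - k))" for m
    by (subst S) (simp add: fps_mult_nth)
  have S0: "fps_nth S 0 = 1" using rec[of 0] by (simp add: A)
  have S1: "fps_nth S 1 = 0" using rec[of 1] by (simp add: A)
  let ?t = "\<lambda>k. fps_nth A k * fps_nth S (n - k)"
  have "fps_nth S n = (\<Sum>k=0..n. ?t k)"
    using rec[of n] \<open>n \<ge> 2\<close> by simp
  also have "\<dots> = (\<Sum>k\<in>insert n {2..n - 2}. ?t k)"
  proof (rule sum.mono_neutral_right)
    show "\<forall>k\<in>{0..n} - insert n {2..n - 2}. ?t k = 0"
    proof
      fix k assume "k \<in> {0..n} - insert n {2..n - 2}"
      hence "k < 2 \<or> n - k = 1" by auto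
      thus "?t k = 0" using S1 by (auto simp: A)
    qed
  qed (use \<open>n \<ge> 2\<close> in auto)
  also have "\<dots> = ?t n + (\<Sum>k=2..n - 2. ?t k)"
    using \<open>n \<ge> 2\<close> by (subst sum.insert) auto
  also have "\<dots> = aharonov n f z + (\<Sum>k = 2..n - 2. aharonov k f z * fps_nth S (n - k))"
    using \<open>n \<ge> 2\<close> S0 by (simp add: A)
  finally show ?thesis by (simp add: sig)
qed

end
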